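(* Let $a\in\mathbb{C}$ and let $c$ be a point of the open unit disk $\mathbb{D}$. Suppose that either $c\neq 0$ and $|a|+|1-a||c|\le 1$, or $c=0$ and $|a|<1$. Let $\varphi(z)=a(z-c)+c$ for $z\in\mathbb{D}$, and suppose that $\varphi$ is loxodromic or a hyperbolic nonautomorphism of the third kind (HNA III). Let $C_\varphi f=f\circ\varphi$ be the composition operator on the Bergman space $L^2_a$. Then the set of extended eigenvalues of $C_\varphi$ is $$\mathrm{Ext}(C_\varphi)=\{\varphi'(c)^n : n\in\mathbb{Z}\}.$$
   Context: The Bergman space $L^2_a$ is the Hilbert space of holomorphic functions $f$ on the open unit disk $\mathbb{D}$ with $\|f\|^2=\frac{1}{\pi}\int_{\mathbb{D}}|f(z)|^2\,dA(z)<\infty$, where $dA$ is Lebesgue area measure. (The subscript $a$ in $L^2_a$ is part of the notation and unrelated to the parameter $a$.) For a bounded linear operator $A$ on a complex Hilbert space $H$, a scalar $\lambda\in\mathbb{C}$ is an extended eigenvalue of $A$ if there is a nonzero bounded linear operator $X$ on $H$ with $AX=\lambda XA$; $\mathrm{Ext}(A)$ denotes the set of all extended eigenvalues of $A$. A map $\varphi(z)=a(z-c)+c$ of $\mathbb{D}$ into itself with fixed points $c\in\mathbb{D}$ and $\infty$, where $0<|a|<1$, is called a hyperbolic nonautomorphism of the third kind (HNA III) if $a$ is a positive real number, and loxodromic otherwise. *)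

theory Defs
  imports "HOL-Complex_Analysis.Complex_Analysis"
begin

text \<open>
  HOL functions are total, so an element of the Bergman space is represented by its extension
  by zero to the whole plane. This makes the representation unique: two elements of the space
  are equal as HOL functions iff they agree on the disk.
\<close>

definition bergman_space :: "(complex \<Rightarrow> complex) set" where
  "bergman_space = {f. f holomorphic_on ball 0 1 \<and> (\<forall>z. z \<notin> ball 0 1 \<longrightarrow> f z = 0) \<and>
     set_integrable lborel (ball 0 1) (\<lambda>z. (cmod (f z))\<^sup>2)}"

definition bergman_norm :: "(complex \<Rightarrow> complex) \<Rightarrow> real" where
  "bergman_norm f = sqrt (1 / pi * (LINT z:ball 0 1|lborel. (cmod (f z))\<^sup>2))"

text \<open>
  A Hilbert space of complex-valued functions, with pointwise operations, is given by its
  carrier \<open>H\<close> and its norm \<open>N\<close>. The behaviour of an operator outside \<open>H\<close> is irrelevant.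
\<close>

definition bounded_operator_on ::
    "('a \<Rightarrow> complex) set \<Rightarrow> (('a \<Rightarrow> complex) \<Rightarrow> real) \<Rightarrow>
     (('a \<Rightarrow> complex) \<Rightarrow> ('a \<Rightarrow> complex)) \<Rightarrow> bool" where
  "bounded_operator_on H N X \<longleftrightarrow>
     (\<forall>f\<in>H. X f \<in> H) \<and>
     (\<forall>f\<in>H. \<forall>g\<in>H. X (\<lambda>z. f z + g z) = (\<lambda>z. X f z + X g z)) \<and>
     (\<forall>f\<in>H. \<forall>\<alpha>::complex. X (\<lambda>z. \<alpha> * f z) = (\<lambda>z. \<alpha> * X f z)) \<and>
     (\<exists>K. \<forall>f\<in>H. N (X f) \<le> K * N f)"

definition extended_eigenvalues ::
    "('a \<Rightarrow> complex) set \<Rightarrow> (('a \<Rightarrow> complex) \<Rightarrow> real) \<Rightarrow>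
     (('a \<Rightarrow> complex) \<Rightarrow> ('a \<Rightarrow> complex)) \<Rightarrow> complex set" where
  "extended_eigenvalues H N A =
     {\<mu>. \<exists>X. bounded_operator_on H N X \<and> (\<exists>f\<in>H. X f \<noteq> (\<lambda>z. 0)) \<and>
             (\<forall>f\<in>H. A (X f) = (\<lambda>z. \<mu> * X (A f) z))}"

definition comp_op :: "(complex \<Rightarrow> complex) \<Rightarrow> (complex \<Rightarrow> complex) \<Rightarrow> (complex \<Rightarrow> complex)" where
  "comp_op \<phi> f = (\<lambda>z. if z \<in> ball 0 1 then f (\<phi> z) else 0)"

text \<open>
  Self-maps of the disk of the form \<open>a (z - c) + c\<close>, i.e. with fixed points \<open>c\<close> in the disk and
  infinity. Only the values of \<open>\<phi>\<close> on the disk matter; they determine \<open>a\<close> and \<open>c\<close>, since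
  \<open>a \<noteq> 1\<close>.
\<close>

definition affine_disk_map :: "complex \<Rightarrow> complex \<Rightarrow> (complex \<Rightarrow> complex) \<Rightarrow> bool" where
  "affine_disk_map a c \<phi> \<longleftrightarrow>
     c \<in> ball 0 1 \<and> 0 < cmod a \<and> cmod a < 1 \<and>
     (\<forall>z\<in>ball 0 1. \<phi> z = a * (z - c) + c) \<and> \<phi> ` ball 0 1 \<subseteq> ball 0 1"

definition HNA_III :: "(complex \<Rightarrow> complex) \<Rightarrow> bool" where
  "HNA_III \<phi> \<longleftrightarrow> (\<exists>a c. affine_disk_map a c \<phi> \<and> (a \<in> \<real> \<and> 0 < Re a))"

definition loxodromic :: "(complex \<Rightarrow> complex) \<Rightarrow> bool" where
  "loxodromic \<phi> \<longleftrightarrow> (\<exists>a c. affine_disk_map a c \<phi> \<and> \<not> (a \<in> \<real> \<and> 0 < Re a))"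

end

theory Submission
  imports Defs
begin

text \<open>
  Write \<open>C\<close> for composition with \<open>\<phi>\<close> and \<open>e\<^sub>j\<close> for \<open>(z - c)^j\<close>. In the coordinate \<open>z - c\<close> the map
  \<open>\<phi>\<close> is multiplication by \<open>a = \<phi>' c\<close>, so \<open>C e\<^sub>j = a^j e\<^sub>j\<close>. Moreover the derivative of order
  \<open>k\<close> of \<open>C f\<close> at \<open>c\<close> is \<open>a^k\<close> times that of \<open>f\<close>, so the eigenvalues of \<open>C\<close> are powers of \<open>a\<close>.

  Suppose \<open>C X = \<mu> X C\<close> with \<open>X\<close> bounded and nonzero. Then \<open>C (X e\<^sub>j) = \<mu> a^j X e\<^sub>j\<close>. Polynomials are
  dense in the Bergman space, so \<open>X e\<^sub>j\<close> is nonzero for some \<open>j\<close>. For this \<open>j\<close> the number \<open>\<mu> a^j\<close> is an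
  eigenvalue of \<open>C\<close>, hence a power \<open>a^k\<close>, and \<open>\<mu> = a^(k - j)\<close>. Conversely, the operator that takes
  \<open>f\<close> to its derivative of order \<open>k\<close> at \<open>c\<close> times \<open>e\<^sub>m\<close> has rank one and realizes \<open>\<mu> = a^(m - k)\<close>;
  these differences are all the integers.

  Two facts about the Bergman space carry the argument. The functional \<open>f \<mapsto> f\<^sup>(\<^sup>k\<^sup>) (c)\<close> is bounded
  (\<open>bergman_higher_deriv_bound\<close>): by the Cauchy estimates this reduces to point evaluations, which
  are bounded by a mean value property over the area of a disk (\<open>weighted_mean_value\<close>). With the
  weight \<open>max 0 (R\<^sup>2 - \<bar>z\<bar>\<^sup>2)\<close> that property follows from translation invariance of Lebesgue measure
  alone, without polar coordinates. Polynomials are dense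
  (\<open>polynomials_dense_in_bergman_space\<close>): the dilations \<open>f (r z)\<close> converge to \<open>f\<close> in norm as \<open>r\<close> tends
  to \<open>1\<close>, and each of them is a uniform limit of its Taylor polynomials.
\<close>

section \<open>A mean value property\<close>

text \<open>
  Translation invariance makes the integral of each difference quotient of \<open>h\<close> vanish. The
  quotients are bounded by a constant on a common ball, so dominated convergence carries this
  over to the directional derivative. This version of the divergence theorem replaces an
  integration by parts.
\<close>

lemma integral_derivative_compact_support_eq_0:
  fixes h :: "'a::euclidean_space \<Rightarrow> 'b::euclidean_space"
  assumes deriv: "\<And>z. (h has_derivative h' z) (at z)"
    and bound: "\<And>z v. norm (h' z v) \<le> B * norm v"
    and supp: "\<And>z. R \<le> norm z \<Longrightarrow> h z = 0"
  shows "integrable lborel (\<lambda>z. h' z v)" and "(LINT z|lborel. h' z v) = 0"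
proof -
  define t where "t = (\<lambda>n. inverse (real (Suc n)))"
  define s where "s = (\<lambda>n z. inverse (t n) *\<^sub>R (h (z + t n *\<^sub>R v) - h z))"
  have t: "0 < t n" "t n \<le> 1" for n
    by (auto simp: t_def field_simps)
  have cont: "continuous_on UNIV h"
    using deriv by (meson continuous_at_imp_continuous_on has_derivative_continuous)
  then have [measurable]: "h \<in> borel_measurable borel"
    by (rule borel_measurable_continuous_onI)
  have [measurable]: "s n \<in> borel_measurable lborel" for n
    unfolding s_def by measurable
  have inth: "integrable lborel h"
  proof -
    have "integrable lborel (\<lambda>x. indicator (cball 0 R) x *\<^sub>R h x)"
      using cont by (intro borel_integrable_compact) (auto intro: continuous_on_subset)
    also have "(\<lambda>x. indicator (cball 0 R) x *\<^sub>R h x) = h"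
      by (auto simp: indicator_def fun_eq_iff intro: supp)
    finally show ?thesis .
  qed
  have lip: "norm (h x - h y) \<le> B * norm (x - y)" for x y
  proof (rule differentiable_bound[where S = UNIV and f' = h'])
    show "onorm (h' x) \<le> B" for x
      using bound by (rule onorm_le)
  qed (use deriv in auto)
  have lim: "(\<lambda>n. s n z) \<longlonglongrightarrow> h' z v" for z
  proof -
    have "linear (h' z)"
      using deriv by (rule has_derivative_linear)
    then have zv: "h' z 0 = 0" "h' z (t n *\<^sub>R v) = t n *\<^sub>R h' z v" for n
      by (simp_all add: linear_0 linear_cmul)
    show ?thesis
    proof (cases "v = 0")
      case True
      then show ?thesis using zv by (simp add: s_def)
    next
      case False
      have "((\<lambda>y. norm (h (z + y) - h z - h' z y) / norm y) \<longlongrightarrow> 0) (at 0)"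
        using deriv[of z] by (simp add: has_derivative_at)
      moreover have "filterlim (\<lambda>n. t n *\<^sub>R v) (at 0) sequentially"
      proof (rule filterlim_atI)
        have "(\<lambda>n. t n *\<^sub>R v) \<longlonglongrightarrow> 0 *\<^sub>R v"
          unfolding t_def by (intro tendsto_intros LIMSEQ_inverse_real_of_nat)
        then show "(\<lambda>n. t n *\<^sub>R v) \<longlonglongrightarrow> 0" by simp
        show "\<forall>\<^sub>F n in sequentially. t n *\<^sub>R v \<noteq> 0"
          using t(1) False by (simp add: less_imp_neq[symmetric])
      qed
      ultimately have "(\<lambda>n. norm (h (z + t n *\<^sub>R v) - h z - h' z (t n *\<^sub>R v)) / norm (t n *\<^sub>R v)) \<longlonglongrightarrow> 0"
        by (rule filterlim_compose)
      then have "(\<lambda>n. norm v * (norm (h (z + t n *\<^sub>R v) - h z - h' z (t n *\<^sub>R v)) / norm (t n *\<^sub>R v))) \<longlonglongrightarrow> norm v * 0"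
        by (rule tendsto_mult_left)
      moreover have "norm v * (norm (h (z + t n *\<^sub>R v) - h z - h' z (t n *\<^sub>R v)) / norm (t n *\<^sub>R v))
           = norm (s n z - h' z v)" for n
      proof -
        have "s n z - h' z v = inverse (t n) *\<^sub>R (h (z + t n *\<^sub>R v) - h z - h' z (t n *\<^sub>R v))"
          using t(1)[of n] by (simp add: s_def zv scaleR_diff_right)
        then show ?thesis using t(1)[of n] False by (simp add: divide_simps)
      qed
      ultimately have "(\<lambda>n. norm (s n z - h' z v)) \<longlonglongrightarrow> 0" by simp
      then show ?thesis
        by (metis LIM_zero_iff tendsto_norm_zero_iff)
    qed
  qed
  have dom: "norm (s n z) \<le> indicator (cball 0 (\<bar>R\<bar> + norm v)) z *\<^sub>R (B * norm v)" for n z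
  proof (cases "z \<in> cball 0 (\<bar>R\<bar> + norm v)")
    case True
    have "norm (s n z) \<le> inverse (t n) * (B * norm (t n *\<^sub>R v))"
      using lip[of "z + t n *\<^sub>R v" z] t[of n] by (simp add: s_def divide_simps mult_ac)
    also have "\<dots> = B * norm v" using t[of n] by simp
    finally show ?thesis using True by simp
  next
    case False
    have "norm z \<le> norm (z + t n *\<^sub>R v) + norm (t n *\<^sub>R v)"
      by (metis add_diff_cancel_right' norm_triangle_ineq4)
    moreover have "norm (t n *\<^sub>R v) \<le> norm v"
      using t[of n] by (simp add: mult_left_le_one_le)
    ultimately have "R \<le> norm z" "R \<le> norm (z + t n *\<^sub>R v)"
      using False norm_ge_zero[of v] by (auto simp del: norm_ge_zero norm_scaleR)
    then show ?thesis using False by (simp add: s_def supp)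
  qed
  have intw: "integrable lborel (\<lambda>z::'a. indicator (cball 0 (\<bar>R\<bar> + norm v)) z *\<^sub>R (B * norm v))"
    by (intro borel_integrable_compact) auto
  have meas: "(\<lambda>z. h' z v) \<in> borel_measurable lborel"
    by (rule borel_measurable_LIMSEQ_metric[of s]) (use lim in auto)
  have zero: "(LINT z|lborel. s n z) = 0" for n
  proof -
    have shift: "distr lborel borel ((+) (t n *\<^sub>R v)) = (lborel :: 'a measure)"
      by (rule lborel_distr_plus)
    have i: "integrable lborel (\<lambda>z. h (t n *\<^sub>R v + z))"
      using inth by (subst (asm) shift[symmetric]) (simp add: integrable_distr_eq)
    have "(LINT z|lborel. h z) = (LINT z|lborel. h (t n *\<^sub>R v + z))"
      by (subst shift[symmetric]) (simp add: integral_distr)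
    then show ?thesis using i inth
      by (simp add: s_def add.commute)
  qed
  show "integrable lborel (\<lambda>z. h' z v)"
    by (rule integrable_dominated_convergence[OF meas _ intw, of s]) (use lim dom in auto)
  have "(\<lambda>n. LINT z|lborel. s n z) \<longlonglongrightarrow> (LINT z|lborel. h' z v)"
    by (rule integral_dominated_convergence[OF meas _ intw]) (use lim dom in auto)
  then show "(LINT z|lborel. h' z v) = 0"
    by (simp add: zero LIMSEQ_const_iff)
qed

lemma DERIV_max_0_power2:
  "((\<lambda>u. (max 0 u)\<^sup>2) has_real_derivative 2 * max 0 u) (at u)"
proof -
  consider "u < 0" | "u = 0" | "u > 0" by linarith
  then show ?thesis
  proof cases
    case 1
    have "((\<lambda>u. 0) has_real_derivative 0) (at u)" by simp
    then have "((\<lambda>u. (max 0 u)\<^sup>2) has_real_derivative 0) (at u)"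
      by (rule has_field_derivative_transform_within_open[where S = "{..<0}"]) (use 1 in auto)
    then show ?thesis using 1 by simp
  next
    case 2
    have "(max 0 h)\<^sup>2 / h = max 0 h" for h :: real
      by (simp add: max_def power2_eq_square)
    moreover have "((\<lambda>h::real. max 0 h) \<longlongrightarrow> max 0 0) (at 0)"
      by (intro tendsto_intros)
    ultimately show ?thesis using 2 by (simp add: DERIV_def)
  next
    case 3
    have "((\<lambda>u. u\<^sup>2) has_real_derivative 2 * u) (at u)"
      by (auto intro!: derivative_eq_intros)
    then have "((\<lambda>u. (max 0 u)\<^sup>2) has_real_derivative 2 * u) (at u)"
      by (rule has_field_derivative_transform_within_open[where S = "{0<..}"]) (use 3 in auto)
    then show ?thesis using 3 by simp
  qed
qed

definition disk_weight :: "real \<Rightarrow> complex \<Rightarrow> real" where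
  "disk_weight R z = max 0 (R\<^sup>2 - (norm z)\<^sup>2)"

lemma integrable_weight_mult:
  fixes g :: "complex \<Rightarrow> 'b::euclidean_space"
  assumes "continuous_on (cball 0 R) g" "0 \<le> R"
  shows "integrable lborel (\<lambda>z. disk_weight R z *\<^sub>R g z)"
proof -
  have "integrable lborel (\<lambda>z. indicator (cball 0 R) z *\<^sub>R (disk_weight R z *\<^sub>R g z))"
    unfolding disk_weight_def
    by (intro borel_integrable_compact continuous_intros assms) auto
  also have "(\<lambda>z. indicator (cball 0 R) z *\<^sub>R (disk_weight R z *\<^sub>R g z)) = (\<lambda>z. disk_weight R z *\<^sub>R g z)"
  proof 
    fix z
    show "indicator (cball 0 R) z *\<^sub>R (disk_weight R z *\<^sub>R g z) = disk_weight R z *\<^sub>R g z"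
      using power_mono[of R "norm z" 2] assms by (auto simp: indicator_def disk_weight_def max_def)
  qed
  finally show ?thesis .
qed

text \<open>
  Write \<open>w\<close> for the weight. The difference quotient \<open>q z = (G z - G 0) / z\<close> extends
  holomorphically over \<open>0\<close>, and the extension by zero of \<open>w\<^sup>2\<close> times \<open>q\<close> is
  differentiable with compact support: the square makes it differentiable across the circle
  of radius \<open>R\<close>. As the combination \<open>D\<^sub>1 + i D\<^sub>i\<close> of directional derivatives kills
  \<open>q\<close>, it takes this product to \<open>- 4 w (G - G 0)\<close>, whose integral is therefore zero.
\<close>

lemma weighted_mean_value:
  assumes holo: "G holomorphic_on ball 0 \<rho>" and R: "0 < R" "R < \<rho>"
  shows "(LINT z|lborel. disk_weight R z *\<^sub>R G z) = (LINT z|lborel. disk_weight R z) *\<^sub>R G 0"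
proof -
  define q where "q = (\<lambda>z. if z = 0 then deriv G 0 else (G z - G 0) / (z - 0))"
  have q: "q holomorphic_on ball 0 \<rho>"
    unfolding q_def by (rule pole_lemma_open) (use holo in auto)
  have qz: "q z * z = G z - G 0" for z by (simp add: q_def)
  define h where "h = (\<lambda>z. (disk_weight R z)\<^sup>2 *\<^sub>R q z)"
  define h' where "h' = (\<lambda>z v. if z \<in> ball 0 \<rho> then
     (2 * disk_weight R z * (- 2 * (z \<bullet> v))) *\<^sub>R q z + (disk_weight R z)\<^sup>2 *\<^sub>R (deriv q z * v) else 0)"
  have w0: "disk_weight R z = 0" if "R \<le> norm z" for z
    using power_mono[OF that, of 2] R by (simp add: disk_weight_def)
  have w1: "0 \<le> disk_weight R z" "disk_weight R z \<le> R\<^sup>2" for z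
    by (auto simp: disk_weight_def)
  have supp: "h z = 0" if "R \<le> norm z" for z
    using w0[OF that] by (simp add: h_def)
  have der: "(h has_derivative h' z) (at z)" for z
  proof (cases "z \<in> ball 0 \<rho>")
    case True
    have "(q has_derivative (\<lambda>v. deriv q z * v)) (at z)"
      using q True by (metis holomorphic_derivI open_ball has_field_derivative_def)
    moreover have "((\<lambda>z. (disk_weight R z)\<^sup>2) has_derivative (\<lambda>v. 2 * disk_weight R z * (- 2 * (z \<bullet> v)))) (at z)"
    proof -
      have "((\<lambda>z. R\<^sup>2 - z \<bullet> z) has_derivative (\<lambda>v. - 2 * (z \<bullet> v))) (at z)"
        by (auto intro!: derivative_eq_intros simp: inner_commute)
      from has_derivative_compose[OF this DERIV_max_0_power2[unfolded has_field_derivative_def]]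
      show ?thesis by (simp add: disk_weight_def power2_norm_eq_inner)
    qed
    ultimately have "(h has_derivative (\<lambda>v. (disk_weight R z)\<^sup>2 *\<^sub>R (deriv q z * v) + (2 * disk_weight R z * (- 2 * (z \<bullet> v))) *\<^sub>R q z)) (at z)"
      unfolding h_def by (intro has_derivative_scaleR)
    then show ?thesis using True by (simp add: h'_def add.commute)
  next
    case False
    have "((\<lambda>z. 0) has_derivative (\<lambda>v. 0)) (at z)" by simp
    then have "(h has_derivative (\<lambda>v. 0)) (at z)"
      by (rule has_derivative_transform_within_open[where s = "- cball 0 R"]) (use False R supp in auto)
    then show ?thesis using False by (simp add: h'_def)
  qed
  obtain B where B: "norm (h' z v) \<le> B * norm v" for z v
  proof -
    have sub: "cball 0 R \<subseteq> ball 0 \<rho>" using R by auto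
    have "bounded (q ` cball 0 R)" "bounded (deriv q ` cball 0 R)"
      using sub q holomorphic_deriv[OF q]
      by (auto intro!: compact_imp_bounded compact_continuous_image holomorphic_on_imp_continuous_on
               intro: holomorphic_on_subset)
    then obtain M M' where M: "norm (q z) \<le> M" "norm (deriv q z) \<le> M'" if "z \<in> cball 0 R" for z
      unfolding bounded_iff by blast
    have M0: "0 \<le> M" "0 \<le> M'" using R order_trans[OF norm_ge_zero M(1)[of 0]] order_trans[OF norm_ge_zero M(2)[of 0]] by auto
    have "norm (h' z v) \<le> (4 * R^3 * M + R^4 * M') * norm v" for z v
    proof (cases "z \<in> cball 0 R")
      case True
      have zv: "\<bar>z \<bullet> v\<bar> \<le> R * norm v"
        using Cauchy_Schwarz_ineq2[of z v] True mult_right_mono[of "norm z" R "norm v"] by auto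
      have "norm (h' z v) \<le> \<bar>2 * disk_weight R z * (- 2 * (z \<bullet> v))\<bar> * norm (q z)
              + (disk_weight R z)\<^sup>2 * (norm (deriv q z) * norm v)"
        using True sub
          norm_triangle_ineq[of "(2 * disk_weight R z * (- 2 * (z \<bullet> v))) *\<^sub>R q z" "(disk_weight R z)\<^sup>2 *\<^sub>R (deriv q z * v)"]
        by (auto simp: h'_def norm_mult)
      also have "\<dots> \<le> (4 * R\<^sup>2 * (R * norm v)) * M + (R\<^sup>2)\<^sup>2 * (M' * norm v)"
      proof (intro add_mono mult_mono power_mono)
        show "\<bar>2 * disk_weight R z * (- 2 * (z \<bullet> v))\<bar> \<le> 4 * R\<^sup>2 * (R * norm v)"
          using mult_mono[OF w1(2)[of z] zv] w1(1)[of z] by (simp add: abs_mult)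
      qed (use M[OF True] M0 w1[of z] R in auto)
      also have "\<dots> = (4 * R^3 * M + R^4 * M') * norm v"
        by (simp add: algebra_simps power_def numeral_eq_Suc)
      finally show ?thesis .
    next
      case False
      then show ?thesis using M0 False R w0[of z] by (auto simp: h'_def)
    qed
    then show ?thesis by (rule that)
  qed
  have int: "integrable lborel (\<lambda>z. h' z v)" and zero: "(LINT z|lborel. h' z v) = 0" for v
    using integral_derivative_compact_support_eq_0[OF der B supp] by blast+
  have dbar: "h' z 1 + \<i> * h' z \<i> = - 4 * (disk_weight R z *\<^sub>R (G z - G 0))" for z
  proof (cases "z \<in> ball 0 \<rho>")
    case True
    have "h' z 1 + \<i> * h' z \<i> = - 4 * disk_weight R z *\<^sub>R (q z * (Re z + \<i> * Im z))"
      using True by (simp add: h'_def scaleR_conv_of_real algebra_simps inner_complex_def)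
    then show ?thesis by (simp add: complex_eq[symmetric] qz)
  next
    case False
    then show ?thesis using R w0[of z] by (simp add: h'_def)
  qed
  have "(LINT z|lborel. h' z 1 + \<i> * h' z \<i>) = 0"
    using int zero by simp
  then have "(LINT z|lborel. disk_weight R z *\<^sub>R (G z - G 0)) = 0"
    unfolding dbar integral_mult_right_zero by simp
  moreover have "integrable lborel (\<lambda>z. disk_weight R z *\<^sub>R G z)"
    using R holo by (intro integrable_weight_mult holomorphic_on_imp_continuous_on)
      (auto intro: holomorphic_on_subset)
  moreover have "integrable lborel (\<lambda>z. disk_weight R z *\<^sub>R G 0)"
    using R by (intro integrable_weight_mult) auto
  moreover have "integrable lborel (disk_weight R)"
    using R integrable_weight_mult[of R "\<lambda>_. 1::real"] by simp
  ultimately show ?thesis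
    by (simp add: scaleR_diff_right)
qed

lemma disk_weight_integral_pos:
  assumes "0 < R"
  shows "0 < (LINT z|lborel. disk_weight R z)"
proof -
  let ?b = "ball 0 (R/2) :: complex set"
  have "0 < 3/4 * R\<^sup>2 * measure lborel ?b"
    using assms by (simp add: content_ball)
  also have "\<dots> = (LINT z|lborel. indicator ?b z * (3/4 * R\<^sup>2))"
    using emeasure_lborel_ball_finite[of "0::complex" "R/2"] by simp
  also have "\<dots> \<le> (LINT z|lborel. disk_weight R z)"
  proof (rule integral_mono)
    show "integrable lborel (\<lambda>z::complex. indicator ?b z * (3/4 * R\<^sup>2))"
      using emeasure_lborel_ball_finite[of "0::complex" "R/2"] by simp
    show "integrable lborel (disk_weight R)"
      using integrable_weight_mult[of R "\<lambda>_. 1::real"] assms by simp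
    show "indicator ?b z * (3/4 * R\<^sup>2) \<le> disk_weight R z" for z
      using power_mono[of "norm z" "R/2" 2] assms
      by (auto simp: indicator_def disk_weight_def power_divide)
  qed
  finally show ?thesis .
qed

section \<open>The Bergman space and its point evaluations\<close>

abbreviation (input) disk :: "complex set" where "disk \<equiv> ball 0 1"

definition zero_ext :: "(complex \<Rightarrow> complex) \<Rightarrow> complex \<Rightarrow> complex" where
  "zero_ext g = (\<lambda>z. if z \<in> disk then g z else 0)"

lemma bergman_spaceD:
  assumes "f \<in> bergman_space"
  shows "f holomorphic_on disk" "\<And>z. z \<notin> disk \<Longrightarrow> f z = 0"
    "f \<in> borel_measurable borel" "integrable lborel (\<lambda>z. (norm (f z))\<^sup>2)"
proof -
  show holo: "f holomorphic_on disk"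
    using assms by (simp add: bergman_space_def)
  show zero: "f z = 0" if "z \<notin> disk" for z
    using assms that unfolding bergman_space_def by blast
  have "(\<lambda>z. indicator disk z *\<^sub>R f z) \<in> borel_measurable borel"
    by (intro borel_measurable_continuous_on_indicator holomorphic_on_imp_continuous_on holo) simp
  moreover have "(\<lambda>z. indicator disk z *\<^sub>R f z) = f"
    using zero by (auto simp: indicator_def fun_eq_iff)
  ultimately show "f \<in> borel_measurable borel" by simp
  have "set_integrable lborel disk (\<lambda>z. (norm (f z))\<^sup>2)"
    using assms by (simp add: bergman_space_def)
  moreover have "(\<lambda>z. indicator disk z *\<^sub>R (norm (f z))\<^sup>2) = (\<lambda>z. (norm (f z))\<^sup>2)"
    using zero by (auto simp: indicator_def fun_eq_iff)
  ultimately show "integrable lborel (\<lambda>z. (norm (f z))\<^sup>2)"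
    by (simp add: set_integrable_def)
qed

lemma bergman_spaceI:
  assumes "f holomorphic_on disk" "\<And>z. z \<notin> disk \<Longrightarrow> f z = 0"
    "integrable lborel (\<lambda>z. (norm (f z))\<^sup>2)"
  shows "f \<in> bergman_space"
proof -
  have "(\<lambda>z. indicator disk z *\<^sub>R (norm (f z))\<^sup>2) = (\<lambda>z. (norm (f z))\<^sup>2)"
    using assms(2) by (auto simp: indicator_def fun_eq_iff)
  then show ?thesis using assms by (simp add: bergman_space_def set_integrable_def)
qed

lemma bergman_norm_eq:
  assumes "\<And>z. z \<notin> disk \<Longrightarrow> f z = 0"
  shows "bergman_norm f = sqrt (1 / pi * (LINT z|lborel. (norm (f z))\<^sup>2))"
proof -
  have "(\<lambda>z. indicator disk z *\<^sub>R (norm (f z))\<^sup>2) = (\<lambda>z. (norm (f z))\<^sup>2)"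
    using assms by (auto simp: indicator_def fun_eq_iff)
  then show ?thesis by (simp add: bergman_norm_def set_lebesgue_integral_def)
qed

lemma bergman_norm_power2:
  assumes "\<And>z. z \<notin> disk \<Longrightarrow> f z = 0"
  shows "(LINT z|lborel. (norm (f z))\<^sup>2) = pi * (bergman_norm f)\<^sup>2"
  by (subst bergman_norm_eq[OF assms]) (auto simp: real_sqrt_pow2)

lemma bergman_norm_nonneg: "0 \<le> bergman_norm f"
  by (simp add: bergman_norm_def set_lebesgue_integral_def)

lemma norm_diff_power2_le: "(norm (u - v))\<^sup>2 \<le> 2 * (norm u)\<^sup>2 + 2 * (norm v)\<^sup>2" for u v :: "'a::real_inner"
  using zero_le_power2[of "norm (u + v)"] unfolding power2_norm_eq_inner
  by (simp add: algebra_simps inner_simps inner_commute)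

lemma zero_ext_in_bergman_space:
  assumes "g holomorphic_on disk" "\<And>z. z \<in> disk \<Longrightarrow> norm (g z) \<le> B"
  shows "zero_ext g \<in> bergman_space" and "bergman_norm (zero_ext g) \<le> B"
proof -
  have holo: "zero_ext g holomorphic_on disk"
    using assms(1) by (rule holomorphic_transform) (simp add: zero_ext_def)
  have "(\<lambda>z. indicator disk z *\<^sub>R zero_ext g z) \<in> borel_measurable borel"
    by (intro borel_measurable_continuous_on_indicator holomorphic_on_imp_continuous_on holo) simp
  moreover have "(\<lambda>z. indicator disk z *\<^sub>R zero_ext g z) = zero_ext g"
    by (auto simp: indicator_def zero_ext_def fun_eq_iff)
  ultimately have [measurable]: "zero_ext g \<in> borel_measurable borel"
    by simp
  have intB: "integrable lborel (\<lambda>z. indicator disk z * B\<^sup>2)"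
    using emeasure_lborel_ball_finite[of "0::complex" 1] by simp
  have "0 \<le> B" using assms(2)[of 0] norm_ge_zero[of "g 0"] by (simp del: norm_ge_zero)
  have le: "(norm (zero_ext g z))\<^sup>2 \<le> indicator disk z * B\<^sup>2" for z
    using assms(2)[of z] by (auto simp: zero_ext_def indicator_def intro: power_mono)
  have int: "integrable lborel (\<lambda>z. (norm (zero_ext g z))\<^sup>2)"
    by (rule Bochner_Integration.integrable_bound[OF intB]) (use le in auto)
  show "zero_ext g \<in> bergman_space"
    by (rule bergman_spaceI[OF holo _ int]) (simp add: zero_ext_def)
  have "(LINT z|lborel. (norm (zero_ext g z))\<^sup>2) \<le> (LINT z|lborel. indicator disk z * B\<^sup>2)"
    using int intB le by (intro integral_mono)
  also have "\<dots> = pi * B\<^sup>2"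
    using emeasure_lborel_ball_finite[of "0::complex" 1] by (simp add: content_ball unit_ball_vol_2)
  finally have "(bergman_norm (zero_ext g))\<^sup>2 \<le> B\<^sup>2"
    by (subst (asm) bergman_norm_power2) (auto simp: zero_ext_def)
  then show "bergman_norm (zero_ext g) \<le> B"
    using \<open>0 \<le> B\<close> by (rule power2_le_imp_le)
qed

lemma bergman_space_diff:
  assumes "f \<in> bergman_space" "g \<in> bergman_space"
  shows "(\<lambda>z. f z - g z) \<in> bergman_space"
proof (rule bergman_spaceI)
  note f = bergman_spaceD[OF assms(1)] and g = bergman_spaceD[OF assms(2)]
  note [measurable] = f(3) g(3)
  show "(\<lambda>z. f z - g z) holomorphic_on disk"
    using f(1) g(1) by (intro holomorphic_intros)
  show "f z - g z = 0" if "z \<notin> disk" for z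
    using f(2)[OF that] g(2)[OF that] by simp
  show "integrable lborel (\<lambda>z. (norm (f z - g z))\<^sup>2)"
  proof (rule Bochner_Integration.integrable_bound)
    show "integrable lborel (\<lambda>z. 2 * (norm (f z))\<^sup>2 + 2 * (norm (g z))\<^sup>2)"
      using f(4) g(4) by simp
    show "AE z in lborel. norm ((norm (f z - g z))\<^sup>2) \<le> norm (2 * (norm (f z))\<^sup>2 + 2 * (norm (g z))\<^sup>2)"
      using norm_diff_power2_le[of "f _" "g _"] by simp
  qed simp
qed

lemma bergman_norm_diff_power2_le:
  assumes "f \<in> bergman_space" "g \<in> bergman_space"
  shows "(bergman_norm (\<lambda>z. f z - g z))\<^sup>2 \<le> 2 * (bergman_norm f)\<^sup>2 + 2 * (bergman_norm g)\<^sup>2"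
proof -
  note f = bergman_spaceD[OF assms(1)] and g = bergman_spaceD[OF assms(2)]
    and d = bergman_spaceD[OF bergman_space_diff[OF assms]]
  have "pi * (bergman_norm (\<lambda>z. f z - g z))\<^sup>2 = (LINT z|lborel. (norm (f z - g z))\<^sup>2)"
    using d by (intro bergman_norm_power2[symmetric])
  also have "\<dots> \<le> (LINT z|lborel. 2 * (norm (f z))\<^sup>2 + 2 * (norm (g z))\<^sup>2)"
    using f(4) g(4) d(4) by (intro integral_mono norm_diff_power2_le) auto
  also have "\<dots> = 2 * (LINT z|lborel. (norm (f z))\<^sup>2) + 2 * (LINT z|lborel. (norm (g z))\<^sup>2)"
    using f(4) g(4) by simp
  also have "\<dots> = pi * (2 * (bergman_norm f)\<^sup>2 + 2 * (bergman_norm g)\<^sup>2)"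
    using bergman_norm_power2[of f] bergman_norm_power2[of g] f(2) g(2) by (simp add: algebra_simps)
  finally show ?thesis by simp
qed

text \<open>
  The weighted mean value property is applied to the square of \<open>f\<close>, again a holomorphic
  function. This bounds \<open>\<bar>f w\<bar>\<^sup>2\<close> directly by the integral of \<open>\<bar>f\<bar>\<^sup>2\<close>. The constant depends
  only on the distance to the unit circle, as the Cauchy estimates below require.
\<close>

lemma bergman_evaluation_bound:
  assumes "0 < \<rho>"
  obtains C where "\<And>f w. \<lbrakk>f \<in> bergman_space; ball w \<rho> \<subseteq> disk\<rbrakk> \<Longrightarrow> norm (f w) \<le> C * bergman_norm f"
proof
  define R where "R = \<rho> / 2"
  have R: "0 < R" "R < \<rho>" using assms by (auto simp: R_def)
  define \<kappa> where "\<kappa> = (LINT z|lborel. disk_weight R z)"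
  have \<kappa>: "0 < \<kappa>" unfolding \<kappa>_def by (rule disk_weight_integral_pos[OF R(1)])
  fix f w assume f: "f \<in> bergman_space" and w: "ball w \<rho> \<subseteq> disk"
  note D = bergman_spaceD[OF f]
  define G where "G = (\<lambda>z. (f (w + z))\<^sup>2)"
  have sub: "w + z \<in> disk" if "z \<in> ball 0 \<rho>" for z
  proof -
    have "w + z \<in> ball w \<rho>" using that by (simp add: dist_norm)
    then show ?thesis using w by blast
  qed
  have "(f \<circ> (\<lambda>z. w + z)) holomorphic_on ball 0 \<rho>"
    by (rule holomorphic_on_compose_gen[OF _ D(1)]) (use w in \<open>auto intro!: holomorphic_intros\<close>)
  then have G: "G holomorphic_on ball 0 \<rho>"
    unfolding G_def o_def by (rule holomorphic_on_power)
  have shift: "distr lborel borel ((+) w) = (lborel :: complex measure)"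
    by (rule lborel_distr_plus)
  have i: "integrable lborel (\<lambda>z. (norm (f (w + z)))\<^sup>2)"
    using D(3,4) by (subst (asm) shift[symmetric]) (simp add: integrable_distr_eq)
  have e: "(LINT z|lborel. (norm (f z))\<^sup>2) = (LINT z|lborel. (norm (f (w + z)))\<^sup>2)"
    using D(3) by (subst shift[symmetric]) (simp add: integral_distr)
  have "\<kappa> * (norm (f w))\<^sup>2 = norm (LINT z|lborel. disk_weight R z *\<^sub>R G z)"
    using \<kappa> by (subst weighted_mean_value[OF G R]) (simp add: \<kappa>_def G_def norm_power)
  also have "\<dots> \<le> (LINT z|lborel. norm (disk_weight R z *\<^sub>R G z))"
    by (rule integral_norm_bound)
  also have "\<dots> \<le> (LINT z|lborel. R\<^sup>2 * (norm (f (w + z)))\<^sup>2)"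
  proof (rule integral_mono)
    have "continuous_on (cball 0 R) G"
      using R by (intro holomorphic_on_imp_continuous_on holomorphic_on_subset[OF G]) auto
    then show "integrable lborel (\<lambda>z. norm (disk_weight R z *\<^sub>R G z))"
      using R by (intro integrable_norm integrable_weight_mult) auto
    show "integrable lborel (\<lambda>z. R\<^sup>2 * (norm (f (w + z)))\<^sup>2)" using i by simp
    have "\<bar>disk_weight R z\<bar> \<le> R\<^sup>2" for z by (auto simp: disk_weight_def)
    then show "norm (disk_weight R z *\<^sub>R G z) \<le> R\<^sup>2 * (norm (f (w + z)))\<^sup>2" for z
      by (simp add: G_def norm_power mult_right_mono)
  qed
  also have "\<dots> = R\<^sup>2 * (pi * (bergman_norm f)\<^sup>2)"
    using bergman_norm_power2[of f] D(2) by (simp add: e[symmetric])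
  finally have "(norm (f w))\<^sup>2 \<le> R\<^sup>2 * pi / \<kappa> * (bergman_norm f)\<^sup>2"
    using \<kappa> by (simp add: field_simps)
  also have "\<dots> = (sqrt (R\<^sup>2 * pi / \<kappa>) * bergman_norm f)\<^sup>2"
    using \<kappa> by (simp add: power_mult_distrib)
  finally show "norm (f w) \<le> sqrt (R\<^sup>2 * pi / \<kappa>) * bergman_norm f"
    by (rule power2_le_imp_le) (use \<kappa> bergman_norm_nonneg in auto)
qed

lemma bergman_higher_deriv_bound:
  assumes "c \<in> disk"
  obtains C where "\<And>f. f \<in> bergman_space \<Longrightarrow> norm ((deriv ^^ k) f c) \<le> C * bergman_norm f"
proof -
  define r where "r = (1 - norm c) / 2"
  have r: "0 < r" using assms by (simp add: r_def)
  obtain C where C: "\<And>f w. \<lbrakk>f \<in> bergman_space; ball w r \<subseteq> disk\<rbrakk> \<Longrightarrow> norm (f w) \<le> C * bergman_norm f"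
    by (rule bergman_evaluation_bound[OF r]) (rule that)
  have sub: "cball c r \<subseteq> disk"
    using assms by (simp add: cball_subset_ball_iff r_def field_simps)
  show ?thesis
  proof (rule that)
    fix f assume f: "f \<in> bergman_space"
    note D = bergman_spaceD[OF f]
    have "norm ((deriv ^^ k) f c) \<le> fact k * (C * bergman_norm f) / r ^ k"
    proof (rule Cauchy_inequality[OF _ _ r])
      show "f holomorphic_on ball c r"
        using D(1) by (rule holomorphic_on_subset) (use sub in auto)
      show "continuous_on (cball c r) f"
        using holomorphic_on_subset[OF D(1) sub] by (rule holomorphic_on_imp_continuous_on)
      show "norm (f x) \<le> C * bergman_norm f" if "norm (c - x) = r" for x
      proof (rule C[OF f])
        have "norm x + r \<le> 1"
          using that norm_triangle_ineq4[of c "c - x"] by (simp add: r_def field_simps)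
        then show "ball x r \<subseteq> disk" by (simp add: ball_subset_ball_iff)
      qed
    qed
    then show "norm ((deriv ^^ k) f c) \<le> (fact k * C / r ^ k) * bergman_norm f"
      by (simp add: field_simps)
  qed
qed

section \<open>Density of polynomials\<close>

text \<open>
  The identity \<open>\<bar>F - f\<bar>\<^sup>2 = 2 \<bar>F\<bar>\<^sup>2 + 2 \<bar>f\<bar>\<^sup>2 - \<bar>F + f\<bar>\<^sup>2\<close> reduces the claim to convergence of the
  integrals of \<open>\<bar>F n + f\<bar>\<^sup>2\<close> to that of \<open>4 \<bar>f\<bar>\<^sup>2\<close>. That is an instance of Scheffe's lemma in
  \<open>L\<^sup>1\<close>, whose hypothesis on the upper limit follows from the same identity.
\<close>

lemma L2_convergence_of_norm_bound:
  fixes F :: "nat \<Rightarrow> 'a \<Rightarrow> 'b::euclidean_space"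
  assumes F[measurable]: "\<And>n. F n \<in> borel_measurable M" and f[measurable]: "f \<in> borel_measurable M"
    and intF: "\<And>n. integrable M (\<lambda>x. (norm (F n x))\<^sup>2)" and intf: "integrable M (\<lambda>x. (norm (f x))\<^sup>2)"
    and lim: "\<And>x. (\<lambda>n. F n x) \<longlonglongrightarrow> f x"
    and le: "\<And>n. (LINT x|M. (norm (F n x))\<^sup>2) \<le> b n"
    and b: "b \<longlonglongrightarrow> (LINT x|M. (norm (f x))\<^sup>2)"
  shows "(\<lambda>n. LINT x|M. (norm (F n x - f x))\<^sup>2) \<longlonglongrightarrow> 0"
proof -
  define I where "I = (LINT x|M. (norm (f x))\<^sup>2)"
  define G where "G = (\<lambda>n x. (norm (F n x + f x))\<^sup>2)"
  define g where "g = (\<lambda>x. (norm (f x + f x))\<^sup>2)"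
  have g_eq: "g x = 4 * (norm (f x))\<^sup>2" for x
    unfolding g_def scaleR_2[symmetric] by (simp add: power_mult_distrib)
  have par: "(norm (F n x - f x))\<^sup>2 = 2 * (norm (F n x))\<^sup>2 + 2 * (norm (f x))\<^sup>2 - G n x" for n x
    unfolding G_def power2_norm_eq_inner by (simp add: inner_simps inner_commute)
  have G_le: "G n x \<le> 2 * (norm (F n x))\<^sup>2 + 2 * (norm (f x))\<^sup>2" for n x
    using par[of n x] zero_le_power2[of "norm (F n x - f x)"] by linarith
  have G0: "0 \<le> G n x" for n x by (simp add: G_def)
  have intG: "integrable M (G n)" for n
  proof (rule Bochner_Integration.integrable_bound)
    show "integrable M (\<lambda>x. 2 * (norm (F n x))\<^sup>2 + 2 * (norm (f x))\<^sup>2)"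
      using intF intf by simp
    show "AE x in M. norm (G n x) \<le> norm (2 * (norm (F n x))\<^sup>2 + 2 * (norm (f x))\<^sup>2)"
      using G_le G0 by simp
  qed (simp add: G_def)
  have intg: "integrable M g" using intf by (simp add: g_eq[abs_def])
  have Ig: "(LINT x|M. g x) = 4 * I" by (simp add: g_eq I_def)
  have "(\<lambda>n. \<integral>\<^sup>+ x. norm (G n x - g x) \<partial>M) \<longlonglongrightarrow> 0"
  proof (rule Scheffe_lemma1[OF intG intg])
    show "AE x in M. (\<lambda>n. G n x) \<longlonglongrightarrow> g x"
      unfolding G_def g_def using lim by (intro AE_I2 tendsto_intros)
    have "(\<integral>\<^sup>+ x. norm (G n x) \<partial>M) \<le> ennreal (2 * b n + 2 * I)" for n
    proof -
      have "(\<integral>\<^sup>+ x. norm (G n x) \<partial>M) = ennreal (LINT x|M. G n x)"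
        using G0 by (simp add: nn_integral_eq_integral[OF intG])
      also have "(LINT x|M. G n x) \<le> (LINT x|M. 2 * (norm (F n x))\<^sup>2 + 2 * (norm (f x))\<^sup>2)"
        using intF intf by (intro integral_mono intG G_le) simp
      also have "\<dots> \<le> 2 * b n + 2 * I"
        using intF intf le[of n] by (simp add: I_def)
      finally show ?thesis by (simp add: ennreal_leI)
    qed
    then have "limsup (\<lambda>n. \<integral>\<^sup>+ x. norm (G n x) \<partial>M) \<le> limsup (\<lambda>n. ennreal (2 * b n + 2 * I))"
      by (intro Limsup_mono always_eventually) blast
    also have "\<dots> = ennreal (2 * I + 2 * I)"
    proof (rule lim_imp_Limsup)
      show "(\<lambda>n. ennreal (2 * b n + 2 * I)) \<longlonglongrightarrow> ennreal (2 * I + 2 * I)"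
        using b by (intro tendsto_intros) (simp add: I_def)
    qed simp
    also have "\<dots> = (\<integral>\<^sup>+ x. norm (g x) \<partial>M)"
      using intg Ig by (subst nn_integral_eq_integral) (auto simp: g_def)
    finally show "limsup (\<lambda>n. \<integral>\<^sup>+ x. norm (G n x) \<partial>M) \<le> (\<integral>\<^sup>+ x. norm (g x) \<partial>M)" .
  qed
  moreover have "(\<integral>\<^sup>+ x. norm (G n x - g x) \<partial>M) = ennreal (LINT x|M. norm (G n x - g x))" for n
    using intG intg by (intro nn_integral_eq_integral) auto
  ultimately have d: "(\<lambda>n. LINT x|M. norm (G n x - g x)) \<longlonglongrightarrow> 0"
    by (simp add: ennreal_tendsto_0_iff)
  have up: "(LINT x|M. (norm (F n x - f x))\<^sup>2) \<le> 2 * b n - 2 * I + (LINT x|M. norm (G n x - g x))" for n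
  proof -
    have "4 * I - (LINT x|M. G n x) = (LINT x|M. g x - G n x)"
      using intG intg by (simp add: Ig)
    also have "\<dots> \<le> (LINT x|M. norm (G n x - g x))"
      using intG intg by (intro integral_mono) auto
    finally have "4 * I - (LINT x|M. G n x) \<le> (LINT x|M. norm (G n x - g x))" .
    moreover have "(LINT x|M. (norm (F n x - f x))\<^sup>2) = 2 * (LINT x|M. (norm (F n x))\<^sup>2) + 2 * I - (LINT x|M. G n x)"
      unfolding par using intF intf intG by (simp add: I_def)
    ultimately show ?thesis using le[of n] by linarith
  qed
  have "(\<lambda>n. 2 * b n - 2 * I + (LINT x|M. norm (G n x - g x))) \<longlonglongrightarrow> 2 * I - 2 * I + 0"
    using b d by (intro tendsto_intros) (simp_all add: I_def)
  then have lim0: "(\<lambda>n. 2 * b n - 2 * I + (LINT x|M. norm (G n x - g x))) \<longlonglongrightarrow> 0" by simp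
  show ?thesis
    by (rule tendsto_sandwich[OF _ _ tendsto_const lim0]) (use up in auto)
qed

lemma integral_dilation:
  fixes g :: "complex \<Rightarrow> real"
  assumes g: "integrable lborel g" and r: "0 < r"
  shows "integrable lborel (\<lambda>z. g (r *\<^sub>R z))"
    and "(LINT z|lborel. g (r *\<^sub>R z)) = (LINT z|lborel. g z) / r\<^sup>2"
proof -
  have m[measurable]: "g \<in> borel_measurable borel" using g by auto
  have eq: "lborel = density (distr lborel borel (\<lambda>z::complex. r *\<^sub>R z)) (\<lambda>_. ennreal (r\<^sup>2))"
    using lborel_affine[of r "0::complex"] r by simp
  have "integrable (density (distr lborel borel (\<lambda>z::complex. r *\<^sub>R z)) (\<lambda>_. ennreal (r\<^sup>2))) g"
    using g eq by metis
  then have "integrable lborel (\<lambda>z. r\<^sup>2 * g (r *\<^sub>R z))"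
    by (simp add: integrable_density integrable_distr_eq)
  then show "integrable lborel (\<lambda>z. g (r *\<^sub>R z))"
    using r by simp
  have "(LINT z|lborel. g z) = (LINT z|density (distr lborel borel (\<lambda>z::complex. r *\<^sub>R z)) (\<lambda>_. ennreal (r\<^sup>2)). g z)"
    using eq by metis
  also have "\<dots> = r\<^sup>2 * (LINT z|lborel. g (r *\<^sub>R z))"
    by (simp add: integral_density integral_distr)
  finally show "(LINT z|lborel. g (r *\<^sub>R z)) = (LINT z|lborel. g z) / r\<^sup>2"
    using r by simp
qed

text \<open>
  Substituting \<open>w = r z\<close> bounds the integral of \<open>\<bar>f (r z)\<bar>\<^sup>2\<close> over the disk by
  \<open>1 / r\<^sup>2\<close> times that of \<open>\<bar>f\<bar>\<^sup>2\<close>. So pointwise convergence of the dilations comes with the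
  convergent upper bound on their norms that forces norm convergence.
\<close>

lemma bergman_dilations_converge:
  assumes f: "f \<in> bergman_space"
    and r: "\<And>n. 0 < r n" "\<And>n. r n < 1" "r \<longlonglongrightarrow> 1"
  shows "\<And>n. zero_ext (\<lambda>z. f (r n *\<^sub>R z)) \<in> bergman_space"
    and "(\<lambda>n. bergman_norm (\<lambda>z. zero_ext (\<lambda>z. f (r n *\<^sub>R z)) z - f z)) \<longlonglongrightarrow> 0"
proof -
  note D = bergman_spaceD[OF f]
  define F where "F = (\<lambda>n. zero_ext (\<lambda>z. f (r n *\<^sub>R z)))"
  have inH: "F n \<in> bergman_space" for n
  proof -
    have sub: "r n *\<^sub>R z \<in> disk" if "z \<in> disk" for z
      using that r(1,2)[of n] mult_left_le_one_le[of "norm z" "r n"] by simp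
    have holo: "(f \<circ> (\<lambda>z. r n *\<^sub>R z)) holomorphic_on disk"
      by (rule holomorphic_on_compose_gen[OF _ D(1)])
        (use sub in \<open>auto simp: scaleR_conv_of_real intro!: holomorphic_intros\<close>)
    have "compact (cball 0 (r n) :: complex set)" "cball 0 (r n) \<subseteq> disk" using r(2)[of n] by auto
    then have "bounded (f ` cball 0 (r n))"
      by (intro compact_imp_bounded compact_continuous_image holomorphic_on_imp_continuous_on
          holomorphic_on_subset[OF D(1)])
    then obtain B where B: "\<And>z. z \<in> cball 0 (r n) \<Longrightarrow> norm (f z) \<le> B"
      unfolding bounded_iff by blast
    have "norm (f (r n *\<^sub>R z)) \<le> B" if "z \<in> disk" for z
      using that r(1)[of n] mult_left_le[of "norm z" "r n"] by (intro B) simp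
    then show ?thesis unfolding F_def
      by (intro zero_ext_in_bergman_space holo[unfolded o_def])
  qed
  then show "zero_ext (\<lambda>z. f (r n *\<^sub>R z)) \<in> bergman_space" for n by (simp add: F_def)
  note FD = bergman_spaceD[OF inH]
  define I where "I = (LINT z|lborel. (norm (f z))\<^sup>2)"
  have "(\<lambda>n. LINT z|lborel. (norm (F n z - f z))\<^sup>2) \<longlonglongrightarrow> 0"
  proof (rule L2_convergence_of_norm_bound)
    show "(LINT z|lborel. (norm (F n z))\<^sup>2) \<le> I / (r n)\<^sup>2" for n
    proof -
      note dil = integral_dilation[OF D(4) r(1)[of n]]
      have "(LINT z|lborel. (norm (F n z))\<^sup>2) \<le> (LINT z|lborel. (norm (f (r n *\<^sub>R z)))\<^sup>2)"
        using dil(1) FD(4) by (intro integral_mono) (auto simp: F_def zero_ext_def)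
      then show ?thesis using dil(2) by (simp add: I_def)
    qed
    have "(\<lambda>n. I / (r n)\<^sup>2) \<longlonglongrightarrow> I / 1\<^sup>2"
      using r(3) by (intro tendsto_intros) auto
    then show "(\<lambda>n. I / (r n)\<^sup>2) \<longlonglongrightarrow> (LINT z|lborel. (norm (f z))\<^sup>2)"
      by (simp add: I_def)
    show "(\<lambda>n. F n z) \<longlonglongrightarrow> f z" for z
    proof (cases "z \<in> disk")
      case True
      have "isCont f z"
        using D(1) True by (meson continuous_on_eq_continuous_at holomorphic_on_imp_continuous_on open_ball)
      moreover have "(\<lambda>n. r n *\<^sub>R z) \<longlonglongrightarrow> 1 *\<^sub>R z"
        using r(3) by (intro tendsto_intros)
      ultimately have "(\<lambda>n. f (r n *\<^sub>R z)) \<longlonglongrightarrow> f z"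
        using isCont_tendsto_compose by fastforce
      then show ?thesis using True by (simp add: F_def zero_ext_def)
    next
      case False
      then show ?thesis using D(2)[OF False] by (simp add: F_def zero_ext_def)
    qed
  qed (use FD(3,4) D(3,4) in auto)
  then have "(\<lambda>n. sqrt (1 / pi * (LINT z|lborel. (norm (F n z - f z))\<^sup>2))) \<longlonglongrightarrow> sqrt (1 / pi * 0)"
    by (intro tendsto_intros)
  moreover have "bergman_norm (\<lambda>z. F n z - f z) = sqrt (1 / pi * (LINT z|lborel. (norm (F n z - f z))\<^sup>2))" for n
    using bergman_spaceD(2)[OF bergman_space_diff[OF inH f]] by (rule bergman_norm_eq)
  ultimately show "(\<lambda>n. bergman_norm (\<lambda>z. zero_ext (\<lambda>z. f (r n *\<^sub>R z)) z - f z)) \<longlonglongrightarrow> 0"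
    by (simp add: F_def)
qed

lemma dilation_uniformly_approximable_by_polynomials:
  assumes f: "f holomorphic_on disk" and r: "0 < r" "r < 1" and e: "0 < e"
  obtains p where "\<And>z. z \<in> disk \<Longrightarrow> norm (f (r *\<^sub>R z) - poly p z) \<le> e"
proof -
  define a where "a = (\<lambda>k. (deriv ^^ k) f 0 / fact k)"
  have sums: "(\<lambda>k. a k * w ^ k) sums f w" if "w \<in> disk" for w
    using holomorphic_power_series[OF f that] by (simp add: a_def)
  \<comment> \<open>Any radius strictly between \<open>r\<close> and \<open>1\<close> serves to show that the Taylor series converges
    uniformly on the closed disk of radius \<open>r\<close>.\<close>
  define \<rho> where "\<rho> = (r + 1) / 2"
  have \<rho>: "r < \<rho>" "\<rho> < 1" "0 < \<rho>" using r by (auto simp: \<rho>_def)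
  have "summable (\<lambda>k. a k * of_real \<rho> ^ k)"
    using sums[of "of_real \<rho>"] \<rho> by (auto simp: sums_iff)
  then have "ereal \<rho> \<le> conv_radius a"
    using conv_radius_geI[of a "of_real \<rho>"] \<rho> by simp
  moreover have "ereal r < ereal \<rho>" using \<rho>(1) by simp
  ultimately have "ereal r < conv_radius a" by (rule less_le_trans[rotated])
  from powser_uniform_limit[OF this, of 0]
  have "\<forall>\<^sub>F n in sequentially. \<forall>x\<in>cball 0 r. dist (\<Sum>i<n. a i * x ^ i) (\<Sum>i. a i * x ^ i) < e"
    using e by (simp add: uniform_limit_iff)
  then obtain n where n: "dist (\<Sum>i<n. a i * x ^ i) (\<Sum>i. a i * x ^ i) < e" if "x \<in> cball 0 r" for x
    unfolding eventually_sequentially by (blast intro: order_refl)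
  show ?thesis
  proof (rule that)
    fix z assume z: "z \<in> disk"
    have rz: "r *\<^sub>R z \<in> cball 0 r" using z r mult_left_le[of "norm z" r] by simp
    then have "r *\<^sub>R z \<in> disk" using r(2) by (simp only: mem_cball mem_ball)
    from sums_unique[OF sums[OF this]] n[OF rz]
    have "norm (f (r *\<^sub>R z) - (\<Sum>i<n. a i * (r *\<^sub>R z) ^ i)) \<le> e"
      by (simp add: dist_norm norm_minus_commute)
    also have "(\<Sum>i<n. a i * (r *\<^sub>R z) ^ i) = poly (\<Sum>i<n. monom (a i * of_real r ^ i) i) z"
      by (simp add: poly_sum poly_monom scaleR_conv_of_real power_mult_distrib mult_ac)
    finally show "norm (f (r *\<^sub>R z) - poly (\<Sum>i<n. monom (a i * of_real r ^ i) i) z) \<le> e" .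
  qed
qed

text \<open>
  A dilation of \<open>f\<close> is near \<open>f\<close> in norm, and it is holomorphic on a larger disk, so that a Taylor
  polynomial is uniformly, hence in norm, near the dilation.
\<close>

lemma polynomials_dense_in_bergman_space:
  assumes f: "f \<in> bergman_space" and e: "0 < e"
  obtains p where "zero_ext (poly p) \<in> bergman_space"
    "bergman_norm (\<lambda>z. zero_ext (poly p) z - f z) < e"
proof -
  define r where "r = (\<lambda>n. 1 - inverse (real (Suc (Suc n))))"
  have r: "0 < r n" "r n < 1" for n by (auto simp: r_def field_simps)
  have "(\<lambda>n. 1 - inverse (real (Suc (Suc n)))) \<longlonglongrightarrow> 1 - 0"
    by (intro tendsto_intros LIMSEQ_Suc[OF LIMSEQ_inverse_real_of_nat])
  then have r1: "r \<longlonglongrightarrow> 1" by (simp add: r_def)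
  define F where "F = (\<lambda>n. zero_ext (\<lambda>z. f (r n *\<^sub>R z)))"
  have F: "F n \<in> bergman_space" for n
    unfolding F_def by (rule bergman_dilations_converge(1)[OF f r r1])
  have "(\<lambda>n. bergman_norm (\<lambda>z. F n z - f z)) \<longlonglongrightarrow> 0"
    unfolding F_def by (rule bergman_dilations_converge(2)[OF f r r1])
  then have "\<forall>\<^sub>F n in sequentially. bergman_norm (\<lambda>z. F n z - f z) < e / 2"
    by (rule order_tendstoD(2)) (use e in simp)
  then obtain n where n: "bergman_norm (\<lambda>z. F n z - f z) < e / 2"
    unfolding eventually_sequentially by blast
  obtain p where p: "\<And>z. z \<in> disk \<Longrightarrow> norm (f (r n *\<^sub>R z) - poly p z) \<le> e / 2"
  proof (rule dilation_uniformly_approximable_by_polynomials[OF bergman_spaceD(1)[OF f] r[of n], of "e / 2"])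
    show "0 < e / 2" using e by simp
  qed (rule that)
  have fh: "(\<lambda>z. f (r n *\<^sub>R z)) holomorphic_on disk"
    using bergman_spaceD(1)[OF F[of n]] by (rule holomorphic_transform) (simp add: F_def zero_ext_def)
  define d where "d = zero_ext (\<lambda>z. f (r n *\<^sub>R z) - poly p z)"
  have d: "d \<in> bergman_space" "bergman_norm d \<le> e / 2"
    unfolding d_def by (intro zero_ext_in_bergman_space[OF _ p] holomorphic_intros fh; simp)+
  have "(\<lambda>z. F n z - d z) = zero_ext (poly p)"
    by (auto simp: F_def d_def zero_ext_def)
  then have P: "zero_ext (poly p) \<in> bergman_space"
    using bergman_space_diff[OF F[of n] d(1)] by simp
  have "(\<lambda>z. zero_ext (poly p) z - f z) = (\<lambda>z. (F n z - f z) - d z)"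
    by (auto simp: F_def d_def zero_ext_def)
  then have "(bergman_norm (\<lambda>z. zero_ext (poly p) z - f z))\<^sup>2
      \<le> 2 * (bergman_norm (\<lambda>z. F n z - f z))\<^sup>2 + 2 * (bergman_norm d)\<^sup>2"
    using bergman_norm_diff_power2_le[OF bergman_space_diff[OF F[of n] f] d(1)] by simp
  also have "\<dots> < 2 * (e / 2)\<^sup>2 + 2 * (e / 2)\<^sup>2"
    using n d(2) bergman_norm_nonneg by (intro add_less_le_mono mult_strict_left_mono mult_left_mono power_strict_mono power_mono) auto
  also have "\<dots> = e\<^sup>2" by (simp add: power2_eq_square)
  finally have "bergman_norm (\<lambda>z. zero_ext (poly p) z - f z) < e"
    using e by (auto intro: power2_less_imp_less)
  with P show ?thesis by (rule that)
qed

definition centered_monomial :: "complex \<Rightarrow> nat \<Rightarrow> complex \<Rightarrow> complex" where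
  "centered_monomial c j = zero_ext (\<lambda>z. (z - c) ^ j)"

lemma zero_ext_poly_in_bergman_space: "zero_ext (poly p) \<in> bergman_space"
proof -
  have "bounded (poly p ` cball 0 1)"
    by (intro compact_imp_bounded compact_continuous_image continuous_intros) auto
  then obtain B where "\<And>z. z \<in> cball 0 1 \<Longrightarrow> norm (poly p z) \<le> B"
    unfolding bounded_iff by blast
  then show ?thesis
    by (intro zero_ext_in_bergman_space(1)[of _ B] holomorphic_intros) auto
qed

lemma centered_monomial_in_bergman_space: "centered_monomial c j \<in> bergman_space"
proof -
  have "poly ([:- c, 1:] ^ j) = (\<lambda>z. (z - c) ^ j)"
    by (simp add: fun_eq_iff)
  then show ?thesis
    using zero_ext_poly_in_bergman_space[of "[:- c, 1:] ^ j"] by (simp add: centered_monomial_def)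
qed

lemma bergman_norm_eq_0:
  assumes f: "f \<in> bergman_space" and "bergman_norm f \<le> 0"
  shows "f = (\<lambda>z. 0)"
proof
  fix z
  show "f z = 0"
  proof (cases "z \<in> disk")
    case True
    obtain C where "\<And>f. f \<in> bergman_space \<Longrightarrow> norm ((deriv ^^ 0) f z) \<le> C * bergman_norm f"
      by (rule bergman_higher_deriv_bound[OF True]) (rule that)
    from this[OF f] show ?thesis using assms(2) bergman_norm_nonneg[of f] by simp
  qed (rule bergman_spaceD(2)[OF f])
qed

text \<open>
  Since polynomials are dense, it suffices that \<open>X\<close> kills each of them. Taylor polynomials at
  \<open>0\<close>, which give the density, are rewritten as polynomials in \<open>z - c\<close>.
\<close>

lemma bounded_operator_eq_0_if_vanishes_on_monomials:
  assumes X: "bounded_operator_on bergman_space bergman_norm X"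
    and zero: "\<And>j. X (centered_monomial c j) = (\<lambda>z. 0)" and f: "f \<in> bergman_space"
  shows "X f = (\<lambda>z. 0)"
proof -
  have XH: "X f \<in> bergman_space" if "f \<in> bergman_space" for f
    using X that by (simp add: bounded_operator_on_def)
  have add: "X (\<lambda>z. f z + g z) = (\<lambda>z. X f z + X g z)" if "f \<in> bergman_space" "g \<in> bergman_space" for f g
    using X that by (simp add: bounded_operator_on_def)
  have scale: "X (\<lambda>z. \<alpha> * f z) = (\<lambda>z. \<alpha> * X f z)" if "f \<in> bergman_space" for f \<alpha>
    using X that by (simp add: bounded_operator_on_def)
  obtain K where K: "bergman_norm (X f) \<le> K * bergman_norm f" if "f \<in> bergman_space" for f
    using X unfolding bounded_operator_on_def by blast
  \<comment> \<open>The factor \<open>(z - c)^j\<close> strengthens the statement for the induction on \<open>q\<close>: splitting off the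
    constant coefficient of \<open>q\<close> raises \<open>j\<close> by one.\<close>
  have shifted: "X (zero_ext (poly ([:- c, 1:] ^ j * pcompose q [:- c, 1:]))) = (\<lambda>z. 0)" for q j
  proof (induction q arbitrary: j)
    case 0
    have "X (\<lambda>z. 0 * centered_monomial c 0 z) = (\<lambda>z. 0)"
      by (subst scale) (simp_all add: centered_monomial_in_bergman_space)
    then show ?case by (simp add: zero_ext_def)
  next
    case (pCons \<alpha> q)
    let ?g = "zero_ext (poly ([:- c, 1:] ^ Suc j * pcompose q [:- c, 1:]))"
    have "zero_ext (poly ([:- c, 1:] ^ j * pcompose (pCons \<alpha> q) [:- c, 1:]))
        = (\<lambda>z. \<alpha> * centered_monomial c j z + ?g z)"
      by (auto simp: zero_ext_def centered_monomial_def pcompose_pCons algebra_simps)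
    moreover have "(\<lambda>z. \<alpha> * centered_monomial c j z) \<in> bergman_space"
      using zero_ext_poly_in_bergman_space[of "smult \<alpha> ([:- c, 1:] ^ j)"]
      by (rule back_subst[of "\<lambda>h. h \<in> bergman_space"])
        (auto simp: zero_ext_def centered_monomial_def)
    ultimately have "X (zero_ext (poly ([:- c, 1:] ^ j * pcompose (pCons \<alpha> q) [:- c, 1:])))
        = (\<lambda>z. \<alpha> * X (centered_monomial c j) z + X ?g z)"
      by (simp only: add scale zero_ext_poly_in_bergman_space centered_monomial_in_bergman_space)
    then show ?case
      by (simp only: zero pCons.IH[of "Suc j"] mult_zero_right add_0_right)
  qed
  have poly0: "X (zero_ext (poly p)) = (\<lambda>z. 0)" for p
  proof -
    have "pcompose (pcompose p [:c, 1:]) [:- c, 1:] = p"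
      by (simp add: pcompose_assoc[symmetric] pcompose_pCons)
    then show ?thesis using shifted[of 0 "pcompose p [:c, 1:]"] by simp
  qed
  have "bergman_norm (X f) \<le> 0"
  proof (rule field_le_epsilon)
    fix \<delta> :: real assume \<delta>: "0 < \<delta>"
    define e where "e = \<delta> / (\<bar>K\<bar> + 1)"
    have "0 < e" using \<delta> by (simp add: e_def)
    then obtain p where p: "bergman_norm (\<lambda>z. zero_ext (poly p) z - f z) < e"
      using polynomials_dense_in_bergman_space[OF f] by metis
    define d where "d = (\<lambda>z. zero_ext (poly p) z - f z)"
    have d: "d \<in> bergman_space"
      unfolding d_def by (rule bergman_space_diff[OF zero_ext_poly_in_bergman_space f])
    have "X (\<lambda>z. d z + f z) = (\<lambda>z. X d z + X f z)" by (rule add[OF d f])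
    then have "X d = (\<lambda>z. - X f z)"
      using poly0[of p] by (simp add: d_def fun_eq_iff add_eq_0_iff)
    then have "bergman_norm (X f) = bergman_norm (X d)"
      by (simp add: bergman_norm_def)
    also have "\<dots> \<le> K * bergman_norm d" by (rule K[OF d])
    also have "\<dots> \<le> (\<bar>K\<bar> + 1) * e"
      using p bergman_norm_nonneg[of d] by (intro mult_mono) (auto simp: d_def)
    also have "\<dots> = \<delta>" by (simp add: e_def)
    finally show "bergman_norm (X f) \<le> 0 + \<delta>" by simp
  qed
  then show ?thesis by (rule bergman_norm_eq_0[OF XH[OF f]])
qed

section \<open>Composition with an affine self-map of the disk\<close>

text \<open>
  The facts about the symbol on which the proof rests. They make \<open>c\<close> a fixed point of \<open>\<phi>\<close> with
  multiplier \<open>a\<close>, and \<open>z - c\<close> a coordinate in which \<open>\<phi>\<close> is multiplication by \<open>a\<close>.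
\<close>

locale affine_self_map =
  fixes a c :: complex and \<phi> :: "complex \<Rightarrow> complex"
  assumes c: "c \<in> disk" and a0: "a \<noteq> 0"
    and \<phi>: "\<And>z. z \<in> disk \<Longrightarrow> \<phi> z = a * (z - c) + c"
    and \<phi>_disk: "\<And>z. z \<in> disk \<Longrightarrow> \<phi> z \<in> disk"
begin

lemma comp_op_centered_monomial:
  "comp_op \<phi> (centered_monomial c j) = (\<lambda>z. a ^ j * centered_monomial c j z)"
  using \<phi> \<phi>_disk
  by (auto simp: comp_op_def centered_monomial_def zero_ext_def fun_eq_iff power_mult_distrib)

lemma higher_deriv_comp_op:
  assumes f: "f holomorphic_on disk"
  shows "(deriv ^^ k) (comp_op \<phi> f) c = a ^ k * (deriv ^^ k) f c"
proof -
  have maps: "a * z + (c - a * c) \<in> disk" if "z \<in> disk" for z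
    using \<phi>_disk[OF that] \<phi>[OF that] by (simp add: algebra_simps)
  have eq: "comp_op \<phi> f z = f (a * z + (c - a * c))" if "z \<in> disk" for z
  proof -
    have "\<phi> z = a * z + (c - a * c)" using \<phi>[OF that] by (simp add: algebra_simps)
    then show ?thesis using that by (simp add: comp_op_def)
  qed
  have "(f \<circ> (\<lambda>z. a * z + (c - a * c))) holomorphic_on disk"
    by (rule holomorphic_on_compose_gen[OF _ f])
      (use maps in \<open>auto intro!: holomorphic_intros\<close>)
  then have holo: "(\<lambda>z. f (a * z + (c - a * c))) holomorphic_on disk"
    by (simp add: o_def)
  then have "comp_op \<phi> f holomorphic_on disk"
    by (rule holomorphic_transform) (simp add: eq)
  then have "(deriv ^^ k) (comp_op \<phi> f) c = (deriv ^^ k) (\<lambda>z. f (a * z + (c - a * c))) c"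
    using holo c eq by (intro higher_deriv_transform_within_open[where S = disk]) auto
  also have "\<dots> = a ^ k * (deriv ^^ k) f (a * c + (c - a * c))"
    using f c maps by (intro higher_deriv_compose_linear'[where S = disk and T = disk]) auto
  finally show ?thesis by simp
qed

text \<open>
  A nonzero \<open>f\<close> has a nonzero derivative of some order \<open>k\<close> at \<open>c\<close>. The derivative of order \<open>k\<close> at
  the fixed point scales by \<open>a ^ k\<close> under composition with \<open>\<phi>\<close>, and by the eigenvalue.
\<close>

lemma eigenvalue_is_power:
  assumes f: "f \<in> bergman_space" "f \<noteq> (\<lambda>z. 0)" and eig: "comp_op \<phi> f = (\<lambda>z. \<mu> * f z)"
  obtains k where "\<mu> = a ^ k"
proof -
  note D = bergman_spaceD[OF f(1)]
  obtain k where k: "(deriv ^^ k) f c \<noteq> 0"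
  proof (rule ccontr)
    assume "\<not> thesis"
    then have zero: "(deriv ^^ k) f c = 0" for k using that by blast
    have "f z = 0" for z
    proof (cases "z \<in> disk")
      case True
      show ?thesis
        by (rule holomorphic_fun_eq_0_on_connected[OF D(1) _ _ zero c True]) auto
    qed (rule D(2))
    then show False using f(2) by auto
  qed
  have "a ^ k * (deriv ^^ k) f c = \<mu> * (deriv ^^ k) f c"
    using higher_deriv_comp_op[OF D(1), of k] higher_deriv_cmult[OF D(1) c open_ball, of k \<mu>]
    unfolding eig by metis
  then have "\<mu> = a ^ k" using k by simp
  then show ?thesis by (rule that)
qed

text \<open>
  An intertwining operator maps \<open>(z - c)^j\<close>, which is an eigenvector for \<open>a ^ j\<close>, to an eigenvector
  for \<open>\<mu> * a ^ j\<close> or to zero; by density, not all of these images are zero. So \<open>\<mu> * a ^ j\<close> is a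
  power of \<open>a\<close> as well.
\<close>

lemma extended_eigenvalue_is_power:
  assumes "\<mu> \<in> extended_eigenvalues bergman_space bergman_norm (comp_op \<phi>)"
  obtains n :: int where "\<mu> = a powi n"
proof -
  obtain X f where X: "bounded_operator_on bergman_space bergman_norm X"
    and f: "f \<in> bergman_space" "X f \<noteq> (\<lambda>z. 0)"
    and inter: "\<And>f. f \<in> bergman_space \<Longrightarrow> comp_op \<phi> (X f) = (\<lambda>z. \<mu> * X (comp_op \<phi> f) z)"
    using assms by (auto simp: extended_eigenvalues_def)
  obtain j where j: "X (centered_monomial c j) \<noteq> (\<lambda>z. 0)"
    using bounded_operator_eq_0_if_vanishes_on_monomials[OF X _ f(1)] f(2) by blast
  have XH: "X (centered_monomial c j) \<in> bergman_space"
    using X centered_monomial_in_bergman_space by (auto simp: bounded_operator_on_def)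
  have "X (comp_op \<phi> (centered_monomial c j)) = (\<lambda>z. a ^ j * X (centered_monomial c j) z)"
    using X centered_monomial_in_bergman_space
    by (simp add: bounded_operator_on_def comp_op_centered_monomial)
  then have "comp_op \<phi> (X (centered_monomial c j)) = (\<lambda>z. (\<mu> * a ^ j) * X (centered_monomial c j) z)"
    using inter[OF centered_monomial_in_bergman_space, of c j] by (simp add: mult.assoc)
  from eigenvalue_is_power[OF XH j this] obtain k where "\<mu> * a ^ j = a ^ k" .
  then have "\<mu> = a powi (int k - int j)"
    using a0 by (simp add: power_int_diff field_simps)
  then show ?thesis by (rule that)
qed

text \<open>
  The witness \<open>X\<close> has rank one: it joins the functional \<open>f \<mapsto> f\<^sup>(\<^sup>k\<^sup>) (c)\<close>, an eigenvector of the
  adjoint of \<open>C\<^sub>\<phi>\<close>, to the eigenvector \<open>(z - c)^m\<close> for \<open>a ^ m\<close>. Hence applying \<open>C\<^sub>\<phi>\<close> after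
  \<open>X\<close> multiplies by \<open>a ^ m\<close>, and applying it before \<open>X\<close> multiplies by \<open>a ^ k\<close>.
\<close>

lemma quotient_of_powers_is_extended_eigenvalue:
  "a ^ m / a ^ k \<in> extended_eigenvalues bergman_space bergman_norm (comp_op \<phi>)"
proof -
  let ?e = "centered_monomial c"
  define X where "X = (\<lambda>f z. (deriv ^^ k) f c * ?e m z)"
  note e = centered_monomial_in_bergman_space
  have scale_e: "(\<lambda>z. \<alpha> * ?e m z) \<in> bergman_space" for \<alpha>
    using zero_ext_poly_in_bergman_space[of "smult \<alpha> ([:- c, 1:] ^ m)"]
    by (rule back_subst[of "\<lambda>h. h \<in> bergman_space"])
      (auto simp: zero_ext_def centered_monomial_def)
  have norm_scale: "bergman_norm (\<lambda>z. \<alpha> * ?e m z) = norm \<alpha> * bergman_norm (?e m)" for \<alpha>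
  proof -
    have "(LINT z:disk|lborel. (norm (\<alpha> * ?e m z))\<^sup>2) = (norm \<alpha>)\<^sup>2 * (LINT z:disk|lborel. (norm (?e m z))\<^sup>2)"
      by (simp add: norm_mult power_mult_distrib)
    then show ?thesis by (simp add: bergman_norm_def real_sqrt_mult real_sqrt_divide)
  qed
  obtain C where C: "\<And>f. f \<in> bergman_space \<Longrightarrow> norm ((deriv ^^ k) f c) \<le> C * bergman_norm f"
    by (rule bergman_higher_deriv_bound[OF c]) (rule that)
  have "bounded_operator_on bergman_space bergman_norm X"
    unfolding bounded_operator_on_def
  proof (intro conjI ballI allI exI)
    fix f assume f: "f \<in> bergman_space"
    note D = bergman_spaceD(1)[OF f]
    show "X f \<in> bergman_space" unfolding X_def by (rule scale_e)
    show "X (\<lambda>z. f z + g z) = (\<lambda>z. X f z + X g z)" if g: "g \<in> bergman_space" for g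
      using higher_deriv_add[OF D bergman_spaceD(1)[OF g] open_ball c]
      by (simp add: X_def algebra_simps)
    show "X (\<lambda>z. \<alpha> * f z) = (\<lambda>z. \<alpha> * X f z)" for \<alpha>
      using higher_deriv_cmult[OF D c open_ball] by (simp add: X_def mult.assoc)
    have "bergman_norm (X f) = norm ((deriv ^^ k) f c) * bergman_norm (?e m)"
      unfolding X_def by (rule norm_scale)
    also have "\<dots> \<le> C * bergman_norm f * bergman_norm (?e m)"
      by (intro mult_right_mono C f bergman_norm_nonneg)
    finally show "bergman_norm (X f) \<le> (C * bergman_norm (?e m)) * bergman_norm f"
      by (simp add: mult_ac)
  qed
  moreover have "X (?e k) \<noteq> (\<lambda>z. 0)"
  proof -
    have "(deriv ^^ k) (?e k) c = (deriv ^^ k) (\<lambda>z. (z - c) ^ k) c"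
      by (rule higher_deriv_transform_within_open[OF bergman_spaceD(1)[OF e] _ open_ball c])
        (auto simp: centered_monomial_def zero_ext_def intro!: holomorphic_intros)
    also have "\<dots> = pochhammer (of_nat (Suc k - k)) k"
      by (simp add: higher_deriv_power)
    also have "\<dots> = fact k" by (simp add: pochhammer_fact)
    finally have "(deriv ^^ k) (?e k) c \<noteq> 0" by simp
    moreover obtain z where "?e m z \<noteq> 0"
    proof (cases "c = 0")
      case True
      then show ?thesis by (intro that[of "1/2"]) (simp add: centered_monomial_def zero_ext_def)
    next
      case False
      then show ?thesis by (intro that[of 0]) (simp add: centered_monomial_def zero_ext_def)
    qed
    ultimately have "X (?e k) z \<noteq> 0" by (simp add: X_def)
    then show ?thesis by auto
  qed
  moreover have "comp_op \<phi> (X f) = (\<lambda>z. a ^ m / a ^ k * X (comp_op \<phi> f) z)" if f: "f \<in> bergman_space" for f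
  proof
    fix z
    have "comp_op \<phi> (X f) z = (deriv ^^ k) f c * comp_op \<phi> (?e m) z"
      by (simp add: X_def comp_op_def)
    also have "\<dots> = a ^ m / a ^ k * X (comp_op \<phi> f) z"
      using a0 by (simp add: X_def comp_op_centered_monomial higher_deriv_comp_op[OF bergman_spaceD(1)[OF f]])
    finally show "comp_op \<phi> (X f) z = a ^ m / a ^ k * X (comp_op \<phi> f) z" .
  qed
  ultimately show ?thesis
    unfolding extended_eigenvalues_def using e by blast
qed

lemma extended_eigenvalues_comp_op:
  "extended_eigenvalues bergman_space bergman_norm (comp_op \<phi>) = {a powi n | n :: int. True}"
proof (intro equalityI subsetI)
  fix \<mu> assume "\<mu> \<in> extended_eigenvalues bergman_space bergman_norm (comp_op \<phi>)"
  then show "\<mu> \<in> {a powi n | n. True}"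
    by (rule extended_eigenvalue_is_power) blast
next
  fix \<mu> assume "\<mu> \<in> {a powi n | n :: int. True}"
  then obtain n :: int where "\<mu> = a powi n" by blast
  \<comment> \<open>One of the two truncated exponents is \<open>0\<close>.\<close>
  also have "\<dots> = a ^ nat n / a ^ nat (- n)"
    by (cases "n \<ge> 0") (auto simp: power_int_def field_simps)
  finally show "\<mu> \<in> extended_eigenvalues bergman_space bergman_norm (comp_op \<phi>)"
    using quotient_of_powers_is_extended_eigenvalue by simp
qed

end

lemma affine_disk_map_coefficient_unique:
  assumes "affine_disk_map a' c' \<phi>" "\<And>z. z \<in> disk \<Longrightarrow> \<phi> z = a * (z - c) + c"
  shows "a' = a"
proof -
  have "a' * (z - c') + c' = a * (z - c) + c" if "z \<in> disk" for z
    using assms that by (auto simp: affine_disk_map_def)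
  from this[of "1/2"] this[of 0]
  have "(a' * (1/2 - c') + c') - (a' * (0 - c') + c') = (a * (1/2 - c) + c) - (a * (0 - c) + c)"
    by simp
  then show ?thesis by (simp add: algebra_simps)
qed

theorem theorem4p5:
  fixes a c :: complex and \<phi> :: "complex \<Rightarrow> complex"
  assumes "c \<in> ball 0 1"
    and "(c \<noteq> 0 \<and> cmod a + cmod (1 - a) * cmod c \<le> 1) \<or> (c = 0 \<and> cmod a < 1)"
    and "\<And>z. z \<in> ball 0 1 \<Longrightarrow> \<phi> z = a * (z - c) + c"
    and "loxodromic \<phi> \<or> HNA_III \<phi>"
  shows "extended_eigenvalues bergman_space bergman_norm (comp_op \<phi>) =
         {deriv \<phi> c powi n | n :: int. True}"
proof -
  obtain a' c' where map: "affine_disk_map a' c' \<phi>"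
    using assms(4) by (auto simp: loxodromic_def HNA_III_def)
  \<comment> \<open>That \<open>\<phi>\<close> is loxodromic or HNA III only asserts that some coefficients exist; the values of \<open>\<phi>\<close> identify the
    multiplier among them as \<open>a\<close>, so that \<open>a\<close> is nonzero and \<open>\<phi>\<close> maps the disk into itself.\<close>
  have "a' = a" using map assms(3) by (rule affine_disk_map_coefficient_unique)
  then have "a \<noteq> 0" "\<phi> ` disk \<subseteq> disk"
    using map by (auto simp: affine_disk_map_def)
  then interpret affine_self_map a c \<phi>
    using assms(1,3) by unfold_locales blast+
  have "((\<lambda>z. a * (z - c) + c) has_field_derivative a) (at c)"
    by (auto intro!: derivative_eq_intros)
  then have "(\<phi> has_field_derivative a) (at c)"
    by (rule has_field_derivative_transform_within_open[where S = disk]) (use c \<phi> in auto)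
  then have "deriv \<phi> c = a" by (rule DERIV_imp_deriv)
  then show ?thesis by (simp only: extended_eigenvalues_comp_op)
qed

end
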